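(* Let $\gamma$ be an even probability density on $\mathbb{R}$ positive in a neighbourhood of the origin. The sub-spherical family $\mathcal{P}^n_\gamma$ is closed with respect to taking convex combinations of its members. Moreover, if $\gamma_1,\gamma_2$ are two such densities, then $\mathcal{P}^n_{\gamma_1}\cup\mathcal{P}^n_{\gamma_2}\subset\mathcal{P}^n_\gamma$, where $\gamma$ is defined by $$\gamma(-s)=\gamma(s)=-\frac{d}{ds}\max_{i=1,2}\int_s^\infty\gamma_i(r)\,dr,\quad s\ge 0.$$
   Context: For an even probability density $\gamma$ on $\mathbb{R}$ positive in a neighbourhood of $0$, set $P_\gamma(\delta)=\int_\delta^\infty\gamma(s)\,ds$. The sub-spherical family $\mathcal{P}^n_\gamma$ is the set of all probability densities $p$ on $\mathbb{R}^n$ (w.r.t. Lebesgue measure) such that $p$ is even and for every unit vector $e\in\mathbb{R}^n$ and every $\delta\ge 0$, $\int_{\{\xi:e^T\xi\ge\delta\}}p(\xi)\,d\xi\le P_\gamma(\delta)$. *)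

theory Defs
  imports "HOL-Analysis.Analysis"
begin

text \<open>An even probability density on the real line, positive in a neighbourhood of 0.\<close>
definition admissible_gamma :: "(real \<Rightarrow> real) \<Rightarrow> bool" where
  "admissible_gamma \<gamma> \<longleftrightarrow>
     (\<forall>s. 0 \<le> \<gamma> s) \<and> \<gamma> \<in> borel_measurable lebesgue \<and>
     (\<integral>\<^sup>+ s. ennreal (\<gamma> s) \<partial>lebesgue) = 1 \<and>
     (\<forall>s. \<gamma> (- s) = \<gamma> s) \<and>
     (\<exists>\<epsilon>>0. \<forall>s. \<bar>s\<bar> < \<epsilon> \<longrightarrow> 0 < \<gamma> s)"

text \<open>The tail function P_gamma(delta) = integral of gamma over [delta, infinity).\<close>
definition tailP :: "(real \<Rightarrow> real) \<Rightarrow> real \<Rightarrow> ennreal" where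
  "tailP \<gamma> \<delta> = (\<integral>\<^sup>+ s \<in> {\<delta>..}. ennreal (\<gamma> s) \<partial>lebesgue)"

text \<open>Probability density on R^n w.r.t. Lebesgue measure.\<close>
definition prob_density :: "('a::euclidean_space \<Rightarrow> real) \<Rightarrow> bool" where
  "prob_density p \<longleftrightarrow>
     (\<forall>x. 0 \<le> p x) \<and> p \<in> borel_measurable lebesgue \<and>
     (\<integral>\<^sup>+ x. ennreal (p x) \<partial>lebesgue) = 1"

text \<open>The sub-spherical family P^n_gamma.\<close>
definition subspherical :: "(real \<Rightarrow> real) \<Rightarrow> ('a::euclidean_space \<Rightarrow> real) set" where
  "subspherical \<gamma> = {p. prob_density p \<and> (\<forall>x. p (- x) = p x) \<and>
      (\<forall>e \<delta>. norm e = 1 \<longrightarrow> 0 \<le> \<delta> \<longrightarrow>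
         (\<integral>\<^sup>+ \<xi> \<in> {\<xi>. \<delta> \<le> e \<bullet> \<xi>}. ennreal (p \<xi>) \<partial>lebesgue) \<le> tailP \<gamma> \<delta>)}"

end

theory Submission
  imports Defs
begin

text \<open>
  Convexity is linearity: a convex combination of even probability densities is one, and the
  half-space integrals, being linear in the density, average the individual bounds.

  For the union, let \<open>M t = max (P\<^sub>1 t) (P\<^sub>2 t)\<close> with \<open>P\<^sub>i\<close> the tail of \<open>\<gamma>\<^sub>i\<close>.
  Then \<open>\<bar>M y - M x\<bar> \<le> \<integral>\<^sub>x\<^sup>y (\<gamma>\<^sub>1 + \<gamma>\<^sub>2)\<close>, so \<open>M\<close> is absolutely continuous and maps
  null sets to null sets (Lusin's property N). Combined with the one-dimensional area formula this
  yields \<open>M \<delta> - M b \<le> \<integral>\<^sub>\<delta>\<^sup>b \<bar>M'\<bar> = \<integral>\<^sub>\<delta>\<^sup>b \<gamma>\<close>, and letting \<open>b \<rightarrow> \<infinity>\<close> gives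
  \<open>P\<^sub>i \<delta> \<le> M \<delta> \<le> P\<^sub>\<gamma> \<delta>\<close> for \<open>\<delta> \<ge> 0\<close>, which is all that membership in the
  sub-spherical family asks for.
\<close>

lemma absolutely_continuous_emeasure_small:
  assumes fin: "finite_measure N" and sets_eq: "sets N = sets M"
    and ac: "absolutely_continuous M N" and e: "0 < e"
  shows "\<exists>d>0. \<forall>A\<in>sets M. emeasure M A < ennreal d \<longrightarrow> emeasure N A < ennreal e"
proof (rule ccontr)
  \<comment> \<open>Otherwise the limsup of sets \<open>A k\<close> with \<open>M (A k) < 2\<^sup>-\<^sup>k\<close> and \<open>N (A k) \<ge> e\<close> is
    \<open>M\<close>-null by Borel-Cantelli, but has \<open>N\<close>-measure at least \<open>e\<close>.\<close>
  assume "\<not> ?thesis"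
  then have "\<forall>k::nat. \<exists>A\<in>sets M. emeasure M A < ennreal ((1/2)^k) \<and> ennreal e \<le> emeasure N A"
    by (metis not_less zero_less_divide_1_iff zero_less_numeral zero_less_power)
  then obtain A where A: "\<And>k. A k \<in> sets M" and small: "\<And>k. emeasure M (A k) < ennreal ((1/2)^k)"
    and large: "\<And>k. ennreal e \<le> emeasure N (A k)"
    by metis
  have M_fin: "emeasure M (A k) < \<infinity>" for k
    using small[of k] ennreal_less_top infinity_ennreal_def by (metis order.strict_trans)
  have "measure M (A k) \<le> (1/2)^k" for k
    using enn2real_mono[OF less_imp_le[OF small[of k]]] by (simp add: measure_def)
  then have "summable (\<lambda>k. measure M (A k))"
    by (intro summable_comparison_test[OF _ summable_geometric[of "1/2::real"]]) auto
  then have "limsup A \<in> null_sets M"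
    using A M_fin by (intro borel_cantelli_limsup1) auto
  then have "emeasure N (limsup A) = 0"
    using ac by (auto simp: absolutely_continuous_def)
  moreover have "ennreal e \<le> emeasure N (limsup A)"
  proof -
    define B where "B n = (\<Union>k\<in>{n..}. A k)" for n
    have B: "B n \<in> sets N" for n
      using A sets_eq by (auto simp: B_def)
    have "ennreal e \<le> (INF n. emeasure N (B n))"
    proof (rule INF_greatest)
      fix n
      have "emeasure N (A n) \<le> emeasure N (B n)"
        using B by (intro emeasure_mono) (auto simp: B_def)
      then show "ennreal e \<le> emeasure N (B n)" using large[of n] by order
    qed
    also have "\<dots> = emeasure N (\<Inter>n. B n)"
    proof (rule INF_emeasure_decseq)
      show "decseq B"
        by (force simp: decseq_def B_def)
    qed (use B finite_measure.emeasure_finite[OF fin] in auto)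
    also have "(\<Inter>n. B n) = limsup A"
      by (simp add: B_def limsup_INF_SUP)
    finally show ?thesis .
  qed
  ultimately show False using e by simp
qed

lemma measure_vec1_image:
  fixes T :: "real set"
  assumes "(vec ` T :: (real^1) set) \<in> lmeasurable"
  shows "T \<in> lmeasurable" and "measure lebesgue T = measure lebesgue (vec ` T :: (real^1) set)"
proof -
  let ?T = "vec ` T :: (real^1) set"
  have "((\<lambda>x::real^1. 1::real) has_integral measure lebesgue ?T) ?T"
    using assms by (simp add: lmeasure_integral lmeasurable_iff_integrable_on has_integral_integral)
  then have "(((\<lambda>x::real^1. 1::real) \<circ> vec) has_integral measure lebesgue ?T) ((\<lambda>x. x $ 1) ` ?T)"
    by (rule has_integral_vec1_I)
  then have T: "((\<lambda>x. 1::real) has_integral measure lebesgue ?T) T"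
    by (simp add: o_def image_image)
  then show "T \<in> lmeasurable"
    using lmeasurable_iff_integrable_on by blast
  with T show "measure lebesgue T = measure lebesgue ?T"
    by (simp add: lmeasure_integral integral_unique)
qed

lemma measure_image_le_integral_abs_deriv:
  fixes g :: "real \<Rightarrow> real"
  assumes S: "S \<in> sets lebesgue"
    and der: "\<And>x. x \<in> S \<Longrightarrow> (g has_real_derivative g' x) (at x within S)"
    and int: "(\<lambda>x. \<bar>g' x\<bar>) integrable_on S"
  shows "g ` S \<in> lmeasurable" and "measure lebesgue (g ` S) \<le> integral S (\<lambda>x. \<bar>g' x\<bar>)"
proof -
  \<comment> \<open>Lift to \<open>real^1\<close>, where the change-of-variables bound for non-injective maps holds.\<close>
  let ?lift = "vec :: real \<Rightarrow> real^1"
  let ?drop = "\<lambda>x::real^1. x $ 1"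
  have S': "?lift ` S \<in> sets lebesgue"
    by (auto intro: differentiable_image_in_sets_lebesgue [OF S] differentiable_vec)
  have "((\<lambda>x. vec (g (x $ 1))) has_derivative (*\<^sub>R) (g' z)) (at (vec z) within ?lift ` S)"
    if "z \<in> S" for z
    using der [OF that]
    by (simp add: has_real_derivative_iff_has_vector_derivative has_vector_derivative_def
        has_derivative_vector_1)
  then have der': "\<And>x. x \<in> ?lift ` S \<Longrightarrow>
        (?lift \<circ> g \<circ> ?drop has_derivative (*\<^sub>R) (g' (?drop x))) (at x within ?lift ` S)"
    by (auto simp: o_def)
  have det: "det (matrix ((*\<^sub>R) c) :: real^1^1) = c" for c :: real
    by (simp add: det_1 matrix_def)
  have drop_lift: "?drop ` ?lift ` S = S"
    by (auto simp: image_image)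
  have int': "(\<lambda>x. \<bar>det (matrix ((*\<^sub>R) (g' (?drop x))) :: real^1^1)\<bar>) integrable_on ?lift ` S"
    unfolding det
  proof -
    obtain I where "((\<lambda>x. \<bar>g' x\<bar>) has_integral I) S"
      using int by (auto simp: integrable_on_def)
    then have "(((\<lambda>x::real^1. \<bar>g' (x$1)\<bar>) \<circ> vec) has_integral I) (?drop ` ?lift ` S)"
      using drop_lift by (simp add: o_def)
    then show "(\<lambda>x::real^1. \<bar>g' (x$1)\<bar>) integrable_on ?lift ` S"
      using has_integral_vec1_D by blast
  qed
  have image: "(?lift \<circ> g \<circ> ?drop) ` ?lift ` S = ?lift ` (g ` S)"
    by (auto simp: image_image)
  have "?lift ` (g ` S) \<in> lmeasurable"
    using measurable_differentiable_image[OF S' der' int'] image by simp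
  note lift = measure_vec1_image[OF this]
  show "g ` S \<in> lmeasurable"
    by (rule lift(1))
  have "integral (?lift ` S) (\<lambda>x. \<bar>det (matrix ((*\<^sub>R) (g' (?drop x))) :: real^1^1)\<bar>)
      = integral S (\<lambda>x. \<bar>g' x\<bar>)"
    unfolding det integral_vec1_eq[of "?lift ` S"] drop_lift by (simp add: o_def)
  then show "measure lebesgue (g ` S) \<le> integral S (\<lambda>x. \<bar>g' x\<bar>)"
    using measure_differentiable_image[OF S' der' int'] image lift(2) by simp
qed

lemma borel_measurable_indicator_deriv:
  fixes g g' :: "real \<Rightarrow> real"
  assumes S: "S \<in> sets lebesgue" and cont: "continuous_on UNIV g"
    and der: "\<And>x. x \<in> S \<Longrightarrow> (g has_real_derivative g' x) (at x)"
  shows "(\<lambda>x. indicator S x * g' x) \<in> borel_measurable lebesgue"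
proof (rule borel_measurable_LIMSEQ_real)
  let ?h = "\<lambda>n. inverse (real (Suc n))"
  fix x
  show "(\<lambda>n. indicator S x * ((g (x + ?h n) - g x) / ?h n)) \<longlonglongrightarrow> indicator S x * g' x"
  proof (cases "x \<in> S")
    case True
    have "filterlim ?h (at 0) sequentially"
      using LIMSEQ_inverse_real_of_nat by (auto simp: filterlim_at)
    then have "(\<lambda>n. (g (x + ?h n) - g x) / ?h n) \<longlonglongrightarrow> g' x"
      using filterlim_compose[OF DERIV_D[OF der[OF True]]] by simp
    with True show ?thesis by simp
  qed simp
next
  fix n
  have "continuous_on UNIV (\<lambda>x. g (x + c))" for c
    by (rule continuous_on_compose2[OF cont continuous_on_add[OF continuous_on_id continuous_on_const]])
      simp
  then have "(\<lambda>x. g (x + c)) \<in> borel_measurable lebesgue" for c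
    by (intro measurable_completion) (simp add: borel_measurable_continuous_onI)
  from this[of "inverse (real (Suc n))"] this[of 0]
  show "(\<lambda>x. indicator S x * ((g (x + inverse (real (Suc n))) - g x) / inverse (real (Suc n))))
      \<in> borel_measurable lebesgue"
    using S by simp
qed

lemma emeasure_image_le_nn_integral_abs_deriv:
  fixes g g' :: "real \<Rightarrow> real"
  assumes S: "S \<in> sets lebesgue" and cont: "continuous_on UNIV g"
    and der: "\<And>x. x \<in> S \<Longrightarrow> (g has_real_derivative g' x) (at x)"
  shows "g ` S \<in> sets lebesgue"
    and "emeasure lebesgue (g ` S) \<le> (\<integral>\<^sup>+x\<in>S. ennreal \<bar>g' x\<bar> \<partial>lebesgue)"
proof -
  have der_within: "\<And>x. x \<in> S \<Longrightarrow> (g has_real_derivative g' x) (at x within S)"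
    using der by (rule has_field_derivative_at_within)
  show "g ` S \<in> sets lebesgue"
    using der_within S
    by (intro differentiable_image_in_sets_lebesgue)
       (auto simp: differentiable_on_def real_differentiable_def)
  define f where "f x = indicator S x * \<bar>g' x\<bar>" for x
  have f_eq: "(\<integral>\<^sup>+x. ennreal (f x) \<partial>lebesgue) = (\<integral>\<^sup>+x\<in>S. ennreal \<bar>g' x\<bar> \<partial>lebesgue)"
    by (intro nn_integral_cong) (simp add: f_def split: split_indicator)
  show "emeasure lebesgue (g ` S) \<le> (\<integral>\<^sup>+x\<in>S. ennreal \<bar>g' x\<bar> \<partial>lebesgue)"
  proof (cases "(\<integral>\<^sup>+x\<in>S. ennreal \<bar>g' x\<bar> \<partial>lebesgue) = \<infinity>")
    case False
    have "(\<lambda>x. \<bar>indicator S x * g' x\<bar>) \<in> borel_measurable lebesgue"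
      using borel_measurable_indicator_deriv[OF S cont der] by measurable
    then have "f \<in> borel_measurable lebesgue"
      by (simp add: f_def[abs_def] abs_mult)
    then have f_int: "integrable lebesgue f"
      using False f_eq by (intro integrableI_nonneg) (auto simp: f_def less_top)
    have f_if: "f = (\<lambda>x. if x \<in> S then \<bar>g' x\<bar> else 0)"
      by (auto simp: f_def fun_eq_iff)
    have int: "(\<lambda>x. \<bar>g' x\<bar>) integrable_on S"
      using integrable_on_lebesgue[OF f_int] unfolding f_if integrable_restrict_UNIV .
    have "integral S (\<lambda>x. \<bar>g' x\<bar>) = integral UNIV f"
      unfolding f_if integral_restrict_UNIV ..
    also have "\<dots> = (\<integral>x. f x \<partial>lebesgue)"
      using f_int by (rule integral_lebesgue)
    finally have "ennreal (integral S (\<lambda>x. \<bar>g' x\<bar>)) = ennreal (\<integral>x. f x \<partial>lebesgue)"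
      by simp
    also have "\<dots> = (\<integral>\<^sup>+x. ennreal (f x) \<partial>lebesgue)"
      by (rule nn_integral_eq_integral[OF f_int, symmetric]) (simp add: f_def)
    moreover note measure_image_le_integral_abs_deriv[OF S der_within int]
    ultimately show ?thesis
      using f_eq by (metis emeasure_eq_measure2 ennreal_leI)
  qed simp
qed

lemma has_real_derivative_nonpos_if_antimono:
  fixes g :: "real \<Rightarrow> real"
  assumes "antimono g" and "(g has_real_derivative D) (at x)"
  shows "D \<le> 0"
proof (rule ccontr)
  assume "\<not> D \<le> 0"
  then obtain d where "0 < d" and "\<And>h. 0 < h \<Longrightarrow> h < d \<Longrightarrow> g x < g (x + h)"
    using DERIV_pos_inc_right[OF assms(2)] by auto
  then have "g x < g (x + d / 2)" by simp
  moreover have "g (x + d / 2) \<le> g x"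
    using \<open>antimono g\<close> \<open>0 < d\<close> by (simp add: antimono_def)
  ultimately show False by simp
qed

lemma null_set_interval_cover:
  fixes N :: "real set"
  assumes N: "N \<in> null_sets lebesgue" and "N \<subseteq> {a..b}" and "0 < e"
  obtains D where "countable D" and "\<And>K. K \<in> D \<Longrightarrow> \<exists>c d. c \<le> d \<and> K = {c..d}"
    and "pairwise (\<lambda>A B. interior A \<inter> interior B = {}) D"
    and "N \<subseteq> \<Union>D" and "\<Union>D \<in> lmeasurable" and "measure lebesgue (\<Union>D) < e"
proof -
  have "N \<in> lmeasurable" "measure lebesgue N = 0"
    using N by (auto intro: fmeasurableI_null_sets simp: measure_eq_0_null_sets)
  moreover have "N \<subseteq> cbox a b" "0 < e / 2"
    using assms by auto
  ultimately obtain D where "countable D"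
    and D: "\<And>K. K \<in> D \<Longrightarrow> K \<subseteq> cbox a b \<and> K \<noteq> {} \<and> (\<exists>c d. K = cbox c d)"
    and "pairwise (\<lambda>A B. interior A \<inter> interior B = {}) D"
    and "N \<subseteq> \<Union>D" "\<Union>D \<in> lmeasurable" "measure lebesgue (\<Union>D) \<le> measure lebesgue N + e / 2"
    using measurable_outer_intervals_bounded[of N a b "e / 2"] by metis
  moreover have "\<exists>c d. c \<le> d \<and> K = {c..d}" if "K \<in> D" for K
    using D[OF that] by fastforce
  ultimately show thesis
    using that \<open>measure lebesgue N = 0\<close> \<open>0 < e\<close> by auto
qed

text \<open>A measure-theoretic form of absolute continuity of \<open>g\<close>.\<close>

locale increments_dominated = finite_measure \<nu> for \<nu> :: "real measure" +
  fixes g :: "real \<Rightarrow> real"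
  assumes sets_eq: "sets \<nu> = sets lebesgue"
    and absolutely_continuous: "absolutely_continuous lebesgue \<nu>"
    and increment_le: "\<And>x y. x \<le> y \<Longrightarrow> \<bar>g y - g x\<bar> \<le> measure \<nu> {x..y}"
begin

lemma uniformly_small_measure:
  assumes "0 < e"
  obtains d where "0 < d" "\<And>A. A \<in> sets lebesgue \<Longrightarrow> emeasure lebesgue A < ennreal d \<Longrightarrow> measure \<nu> A < e"
proof -
  obtain d where "0 < d" and d: "\<forall>A\<in>sets lebesgue. emeasure lebesgue A < ennreal d \<longrightarrow> emeasure \<nu> A < ennreal e"
    using absolutely_continuous_emeasure_small[OF finite_measure_axioms sets_eq absolutely_continuous assms]
    by blast
  have "measure \<nu> A < e" if "A \<in> sets lebesgue" "emeasure lebesgue A < ennreal d" for A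
    using d that assms sets_eq by (simp add: emeasure_eq_measure ennreal_less_iff)
  with \<open>0 < d\<close> that show thesis by blast
qed

lemma continuous: "continuous_on UNIV g"
proof -
  have "isCont g x" for x
  proof (rule continuous_at_eps_delta[THEN iffD2], intro allI impI)
    fix e :: real assume "0 < e"
    then obtain d where "0 < d" and d: "\<And>A. A \<in> sets lebesgue \<Longrightarrow> emeasure lebesgue A < ennreal d \<Longrightarrow> measure \<nu> A < e"
      using uniformly_small_measure by metis
    have "dist (g y) (g x) < e" if "dist y x < d" for y
    proof -
      have "\<bar>g y - g x\<bar> \<le> measure \<nu> {min x y..max x y}"
        using increment_le[of "min x y" "max x y"] by (cases "x \<le> y") (auto simp: abs_minus_commute)
      also have "\<dots> < e"
        using that \<open>0 < d\<close> by (intro d) (auto simp: dist_real_def ennreal_less_iff)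
      finally show ?thesis by (simp add: dist_real_def)
    qed
    with \<open>0 < d\<close> show "\<exists>d>0. \<forall>y. dist y x < d \<longrightarrow> dist (g y) (g x) < e" by blast
  qed
  then show ?thesis by (simp add: continuous_on_eq_continuous_at)
qed

lemma measure_greaterThanLessThan_eq: "measure \<nu> {c<..<d} = measure \<nu> {c..d}"
proof -
  have "{c, d} \<in> null_sets \<nu>"
    using absolutely_continuous by (auto simp: absolutely_continuous_def intro: null_sets_completionI)
  then have "measure \<nu> ({c..d} - {c, d}) = measure \<nu> {c..d}"
    using sets_eq by (intro measure_Diff_null_set) auto
  moreover have "{c..d} - {c, d} = {c<..<d}" by auto
  ultimately show ?thesis by simp
qed

lemma measure_UN_interval_balls_le:
  fixes z :: "real set \<Rightarrow> real"
  assumes "countable D" and intervals: "\<And>K. K \<in> D \<Longrightarrow> \<exists>c d. c \<le> d \<and> K = {c..d}"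
    and disj: "pairwise (\<lambda>A B. interior A \<inter> interior B = {}) D" and "\<Union>D \<in> sets lebesgue"
  shows "(\<Union>K\<in>D. cball (z K) (measure \<nu> K)) \<in> lmeasurable"
    and "measure lebesgue (\<Union>K\<in>D. cball (z K) (measure \<nu> K)) \<le> 2 * measure \<nu> (\<Union>D)"
proof -
  have bound: "measure lebesgue (\<Union>K\<in>D'. cball (z K) (measure \<nu> K)) \<le> 2 * measure \<nu> (\<Union>D)"
    if "D' \<subseteq> D" "finite D'" for D'
  proof -
    have "measure lebesgue (\<Union>K\<in>D'. cball (z K) (measure \<nu> K))
        \<le> (\<Sum>K\<in>D'. measure lebesgue (cball (z K) (measure \<nu> K)))"
      using that by (intro measure_UNION_le) auto
    also have "\<dots> = 2 * (\<Sum>K\<in>D'. measure \<nu> (interior K))"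
      unfolding sum_distrib_left
    proof (rule sum.cong)
      fix K assume "K \<in> D'"
      then obtain c d where "c \<le> d" "K = {c..d}"
        using intervals \<open>D' \<subseteq> D\<close> by (meson subsetD)
      then show "measure lebesgue (cball (z K) (measure \<nu> K)) = 2 * measure \<nu> (interior K)"
        by (simp add: cball_eq_atLeastAtMost measure_greaterThanLessThan_eq)
    qed simp
    also have "(\<Sum>K\<in>D'. measure \<nu> (interior K)) = measure \<nu> (\<Union>K\<in>D'. interior K)"
      using disj that sets_eq
      by (intro finite_measure_finite_Union[symmetric])
         (auto simp: disjoint_family_on_def pairwise_def)
    also have "\<dots> \<le> measure \<nu> (\<Union>D)"
      using that \<open>\<Union>D \<in> sets lebesgue\<close> interior_subset sets_eq
      by (intro finite_measure_mono) auto
    finally show ?thesis by simp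
  qed
  have balls: "cball (z K) (measure \<nu> K) \<in> lmeasurable" for K
    by simp
  show "(\<Union>K\<in>D. cball (z K) (measure \<nu> K)) \<in> lmeasurable"
    by (rule fmeasurable_UN_bound[OF \<open>countable D\<close> balls bound])
  show "measure lebesgue (\<Union>K\<in>D. cball (z K) (measure \<nu> K)) \<le> 2 * measure \<nu> (\<Union>D)"
    by (rule measure_UN_bound[OF \<open>countable D\<close> balls bound])
qed

lemma null_sets_image:
  assumes N: "N \<in> null_sets lebesgue" and N_sub: "N \<subseteq> {a..b}"
  shows "g ` N \<in> null_sets lebesgue"
proof -
  have "\<exists>T. g ` N \<subseteq> T \<and> T \<in> lmeasurable \<and> measure lebesgue T \<le> e" if "0 < e" for e
  proof -
    obtain d where "0 < d"
      and d: "\<And>A. A \<in> sets lebesgue \<Longrightarrow> emeasure lebesgue A < ennreal d \<Longrightarrow> measure \<nu> A < e / 2"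
      using uniformly_small_measure[of "e / 2"] \<open>0 < e\<close> by (metis half_gt_zero)
    obtain D where "countable D" and intervals: "\<And>K. K \<in> D \<Longrightarrow> \<exists>c d. c \<le> d \<and> K = {c..d}"
      and "pairwise (\<lambda>A B. interior A \<inter> interior B = {}) D"
      and N_cover: "N \<subseteq> \<Union>D" and "\<Union>D \<in> lmeasurable" and "measure lebesgue (\<Union>D) < d"
      using null_set_interval_cover[OF N N_sub \<open>0 < d\<close>] by blast
    have "measure \<nu> (\<Union>D) < e / 2"
      using \<open>\<Union>D \<in> lmeasurable\<close> \<open>measure lebesgue (\<Union>D) < d\<close>
      by (intro d) (auto simp: emeasure_eq_measure2 ennreal_less_iff)
    \<comment> \<open>\<open>g\<close> maps each covering interval \<open>K\<close> into the ball of radius \<open>\<nu> K\<close> around \<open>g (Inf K)\<close>.\<close>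
    define T where "T = (\<Union>K\<in>D. cball (g (Inf K)) (measure \<nu> K))"
    have "g ` N \<subseteq> T"
    proof
      fix y assume "y \<in> g ` N"
      then obtain x K where "y = g x" "x \<in> K" "K \<in> D"
        using N_cover by blast
      moreover obtain c d where "c \<le> d" "K = {c..d}"
        using intervals[OF \<open>K \<in> D\<close>] by blast
      moreover have "measure \<nu> {c..x} \<le> measure \<nu> {c..d}"
        using \<open>x \<in> K\<close> \<open>K = {c..d}\<close> sets_eq by (intro finite_measure_mono) auto
      ultimately have "dist (g (Inf K)) y \<le> measure \<nu> K"
        using increment_le[of c x] by (simp add: dist_real_def)
      then show "y \<in> T"
        unfolding T_def using \<open>K \<in> D\<close> by auto
    qed
    moreover note measure_UN_interval_balls_le[OF \<open>countable D\<close> intervals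
        \<open>pairwise _ D\<close>, of "\<lambda>K. g (Inf K)", folded T_def]
    ultimately show ?thesis
      using \<open>\<Union>D \<in> lmeasurable\<close> \<open>measure \<nu> (\<Union>D) < e / 2\<close> by (intro exI[of _ T]) auto
  qed
  then show ?thesis
    by (simp add: negligible_outer_le flip: negligible_iff_null_sets)
qed

lemma diff_le_nn_integral_abs_deriv:
  assumes "a \<le> b" and N: "N \<in> null_sets lebesgue"
    and der: "\<And>s. s \<in> {a..b} - N \<Longrightarrow> (g has_real_derivative g' s) (at s)"
  shows "ennreal (g a - g b) \<le> (\<integral>\<^sup>+s\<in>{a..b}. ennreal \<bar>g' s\<bar> \<partial>lebesgue)"
proof (cases "g b \<le> g a")
  case True
  define S where "S = {a..b} - N"
  have S: "S \<in> sets lebesgue"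
    using N by (auto simp: S_def)
  note image = emeasure_image_le_nn_integral_abs_deriv[OF S continuous der[folded S_def]]
  have null: "g ` (N \<inter> {a..b}) \<in> null_sets lebesgue"
    using N by (intro null_sets_image[of _ a b] null_set_Int2) auto
  have "{g b..g a} \<subseteq> g ` S \<union> g ` (N \<inter> {a..b})"
  proof
    fix y assume "y \<in> {g b..g a}"
    then obtain x where "a \<le> x" "x \<le> b" "g x = y"
      using IVT2'[of g b y a] \<open>a \<le> b\<close> continuous_on_subset[OF continuous] by auto
    then show "y \<in> g ` S \<union> g ` (N \<inter> {a..b})"
      by (auto simp: S_def)
  qed
  then have "emeasure lebesgue {g b..g a} \<le> emeasure lebesgue (g ` S \<union> g ` (N \<inter> {a..b}))"
    using image(1) null by (intro emeasure_mono) auto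
  then have "ennreal (g a - g b) \<le> emeasure lebesgue (g ` S \<union> g ` (N \<inter> {a..b}))"
    using True by simp
  also have "\<dots> = emeasure lebesgue (g ` S)"
    using image(1) null by (rule emeasure_Un_null_set)
  also have "\<dots> \<le> (\<integral>\<^sup>+s\<in>S. ennreal \<bar>g' s\<bar> \<partial>lebesgue)"
    by (rule image(2))
  also have "\<dots> \<le> (\<integral>\<^sup>+s\<in>{a..b}. ennreal \<bar>g' s\<bar> \<partial>lebesgue)"
    by (intro nn_integral_mono) (auto simp: S_def split: split_indicator)
  finally show ?thesis .
qed (simp add: ennreal_neg)

lemma ennreal_le_tailP:
  assumes antimono: "antimono g" and lim: "(g \<longlongrightarrow> 0) at_top"
    and der: "AE s in lebesgue. 0 \<le> s \<longrightarrow> (g has_real_derivative - \<gamma> s) (at s)"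
    and "0 \<le> \<delta>"
  shows "ennreal (g \<delta>) \<le> tailP \<gamma> \<delta>"
proof -
  obtain N where N: "N \<in> null_sets lebesgue"
    and der_N: "\<And>s. s \<notin> N \<Longrightarrow> 0 \<le> s \<Longrightarrow> (g has_real_derivative - \<gamma> s) (at s)"
    using der by (rule AE_E3) auto
  have \<gamma>_nonneg: "0 \<le> \<gamma> s" if "s \<notin> N" "0 \<le> s" for s
    using has_real_derivative_nonpos_if_antimono[OF antimono der_N[OF that]] by simp
  have "ennreal (g \<delta>) \<le> tailP \<gamma> \<delta> + ennreal e" if "0 < e" for e
  proof -
    obtain b0 where "\<And>t. b0 \<le> t \<Longrightarrow> g t < e"
      using order_tendstoD(2)[OF lim \<open>0 < e\<close>] by (auto simp: eventually_at_top_linorder)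
    then obtain b where "\<delta> \<le> b" "g b < e"
      by (meson max.cobounded1 max.cobounded2)
    have "0 \<le> g b"
    proof (rule tendsto_upperbound[OF lim])
      show "\<forall>\<^sub>F t in at_top. g t \<le> g b"
        using antimono by (auto simp: eventually_at_top_linorder antimono_def)
    qed simp
    have "g b \<le> g \<delta>"
      using antimono \<open>\<delta> \<le> b\<close> by (simp add: antimono_def)
    have "ennreal (g \<delta> - g b) \<le> (\<integral>\<^sup>+s\<in>{\<delta>..b}. ennreal \<bar>- \<gamma> s\<bar> \<partial>lebesgue)"
      using \<open>0 \<le> \<delta>\<close> by (intro diff_le_nn_integral_abs_deriv[OF \<open>\<delta> \<le> b\<close> N] der_N) auto
    also have "\<dots> \<le> tailP \<gamma> \<delta>"
      unfolding tailP_def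
    proof (rule nn_integral_mono_AE)
      show "AE s in lebesgue. ennreal \<bar>- \<gamma> s\<bar> * indicator {\<delta>..b} s \<le> ennreal (\<gamma> s) * indicator {\<delta>..} s"
        using AE_not_in[OF N]
        by eventually_elim (use \<gamma>_nonneg \<open>0 \<le> \<delta>\<close> in \<open>auto split: split_indicator\<close>)
    qed
    finally have tail_bound: "ennreal (g \<delta> - g b) \<le> tailP \<gamma> \<delta>" .
    have "ennreal (g \<delta>) = ennreal (g \<delta> - g b) + ennreal (g b)"
      using \<open>0 \<le> g b\<close> \<open>g b \<le> g \<delta>\<close> by (simp flip: ennreal_plus)
    also have "\<dots> \<le> tailP \<gamma> \<delta> + ennreal e"
      using tail_bound \<open>g b < e\<close> by (intro add_mono ennreal_leI) simp_all
    finally show ?thesis .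
  qed
  then show ?thesis
    by (rule ennreal_le_epsilon)
qed

end

lemma tendsto_measure_atLeast_at_top:
  fixes M :: "real measure"
  assumes "finite_measure M" and "\<And>t. {t..} \<in> sets M"
  shows "((\<lambda>t. measure M {t..}) \<longlongrightarrow> 0) at_top"
proof -
  have "(\<lambda>n. measure M {real n..}) \<longlonglongrightarrow> measure M (\<Inter>n. {real n..})"
    using assms by (intro finite_measure.finite_Lim_measure_decseq) (auto simp: decseq_def)
  moreover have "(\<Inter>n. {real n..}) = {}"
    using reals_Archimedean2 by (meson INT_E UNIV_I atLeast_iff equals0I linorder_not_le)
  ultimately have "(\<lambda>n. measure M {real n..}) \<longlonglongrightarrow> 0"
    by simp
  then have "(\<lambda>n. - measure M {real n..}) \<longlonglongrightarrow> - 0"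
    by (rule tendsto_minus)
  moreover have "mono (\<lambda>t. - measure M {t..})"
    using assms by (auto simp: mono_def intro!: finite_measure.finite_measure_mono)
  ultimately have "((\<lambda>t. - measure M {t..}) \<longlongrightarrow> - 0) at_top"
    by (intro tendsto_at_topI_sequentially_real)
  from tendsto_minus[OF this] show ?thesis
    by simp
qed

lemma finite_measure_density_admissible:
  assumes "admissible_gamma \<gamma>"
  shows "finite_measure (density lebesgue (\<lambda>s. ennreal (\<gamma> s)))"
  using assms by (intro finite_measureI) (auto simp: admissible_gamma_def emeasure_density)

lemma tailP_eq_measure:
  assumes "admissible_gamma \<gamma>"
  shows "tailP \<gamma> t = ennreal (measure (density lebesgue (\<lambda>s. ennreal (\<gamma> s))) {t..})"
proof -
  have "tailP \<gamma> t = emeasure (density lebesgue (\<lambda>s. ennreal (\<gamma> s))) {t..}"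
    using assms by (simp add: tailP_def emeasure_density admissible_gamma_def)
  also have "\<dots> = ennreal (measure (density lebesgue (\<lambda>s. ennreal (\<gamma> s))) {t..})"
    using finite_measure.emeasure_eq_measure[OF finite_measure_density_admissible[OF assms]] .
  finally show ?thesis .
qed

lemma abs_measure_atLeast_diff_le:
  fixes \<mu> :: "real measure"
  assumes "finite_measure \<mu>" and "sets \<mu> = sets lebesgue" and "x \<le> y"
  shows "\<bar>measure \<mu> {y..} - measure \<mu> {x..}\<bar> \<le> measure \<mu> {x..y}"
proof -
  interpret finite_measure \<mu> by fact
  have "measure \<mu> {x..} - measure \<mu> {y..} = measure \<mu> ({x..} - {y..})"
    using assms by (intro finite_measure_Diff[symmetric]) auto
  also have "\<dots> \<le> measure \<mu> {x..y}"
    using assms by (intro finite_measure_mono) auto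
  finally have "measure \<mu> {x..} - measure \<mu> {y..} \<le> measure \<mu> {x..y}" .
  moreover have "measure \<mu> {y..} \<le> measure \<mu> {x..}"
    using assms by (intro finite_measure_mono) auto
  ultimately show ?thesis
    by (simp add: abs_le_iff)
qed

lemma increments_dominated_max_tails:
  assumes a1: "admissible_gamma \<gamma>1" and a2: "admissible_gamma \<gamma>2"
  shows "increments_dominated (density lebesgue (\<lambda>s. ennreal (\<gamma>1 s + \<gamma>2 s)))
           (\<lambda>t. max (enn2real (tailP \<gamma>1 t)) (enn2real (tailP \<gamma>2 t)))"
proof -
  define \<mu>1 where "\<mu>1 = density lebesgue (\<lambda>s. ennreal (\<gamma>1 s))"
  define \<mu>2 where "\<mu>2 = density lebesgue (\<lambda>s. ennreal (\<gamma>2 s))"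
  define \<nu> where "\<nu> = density lebesgue (\<lambda>s. ennreal (\<gamma>1 s + \<gamma>2 s))"
  have \<mu>1: "finite_measure \<mu>1" and \<mu>2: "finite_measure \<mu>2"
    unfolding \<mu>1_def \<mu>2_def using a1 a2 by (auto intro: finite_measure_density_admissible)
  have [measurable]: "\<gamma>1 \<in> borel_measurable lebesgue" "\<gamma>2 \<in> borel_measurable lebesgue"
    using a1 a2 by (auto simp: admissible_gamma_def)
  have emeasure_\<nu>: "emeasure \<nu> A = emeasure \<mu>1 A + emeasure \<mu>2 A" if "A \<in> sets lebesgue" for A
    using emeasure_density_add[OF that, of "\<lambda>s. ennreal (\<gamma>1 s)" "\<lambda>s. ennreal (\<gamma>2 s)"] a1 a2
    by (simp add: \<nu>_def \<mu>1_def \<mu>2_def admissible_gamma_def ennreal_plus)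
  have \<nu>: "finite_measure \<nu>"
    using emeasure_\<nu>[of UNIV] finite_measure.emeasure_finite[OF \<mu>1] finite_measure.emeasure_finite[OF \<mu>2]
    by (intro finite_measureI) (auto simp: \<nu>_def \<mu>1_def \<mu>2_def)
  have measure_\<nu>: "measure \<nu> A = measure \<mu>1 A + measure \<mu>2 A" if "A \<in> sets lebesgue" for A
    using emeasure_\<nu>[OF that] finite_measure.emeasure_finite[OF \<mu>1] finite_measure.emeasure_finite[OF \<mu>2]
    by (simp add: measure_def enn2real_plus less_top)
  have tails: "enn2real (tailP \<gamma>1 t) = measure \<mu>1 {t..}" "enn2real (tailP \<gamma>2 t) = measure \<mu>2 {t..}" for t
    using tailP_eq_measure[OF a1] tailP_eq_measure[OF a2] by (simp_all add: \<mu>1_def \<mu>2_def)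
  show ?thesis
    unfolding \<nu>_def[symmetric] tails
  proof (intro increments_dominated.intro[OF \<nu>] increments_dominated_axioms.intro)
    show "sets \<nu> = sets lebesgue" "absolutely_continuous lebesgue \<nu>"
      by (auto simp: \<nu>_def intro: absolutely_continuousI_density)
    fix x y :: real assume "x \<le> y"
    have "\<bar>max (measure \<mu>1 {y..}) (measure \<mu>2 {y..}) - max (measure \<mu>1 {x..}) (measure \<mu>2 {x..})\<bar>
        \<le> \<bar>measure \<mu>1 {y..} - measure \<mu>1 {x..}\<bar> + \<bar>measure \<mu>2 {y..} - measure \<mu>2 {x..}\<bar>"
      by (simp add: max_def abs_if)
    also have "\<dots> \<le> measure \<mu>1 {x..y} + measure \<mu>2 {x..y}"
      using \<mu>1 \<mu>2 \<open>x \<le> y\<close>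
      by (intro add_mono abs_measure_atLeast_diff_le) (auto simp: \<mu>1_def \<mu>2_def)
    also have "\<dots> = measure \<nu> {x..y}"
      by (simp add: measure_\<nu>)
    finally show "\<bar>max (measure \<mu>1 {y..}) (measure \<mu>2 {y..}) - max (measure \<mu>1 {x..}) (measure \<mu>2 {x..})\<bar>
        \<le> measure \<nu> {x..y}" .
  qed
qed

lemma tailP_le_of_max_tailP_deriv:
  assumes a1: "admissible_gamma \<gamma>1" and a2: "admissible_gamma \<gamma>2"
    and der: "AE s in lebesgue. 0 \<le> s \<longrightarrow>
           ((\<lambda>t. max (enn2real (tailP \<gamma>1 t)) (enn2real (tailP \<gamma>2 t)))
              has_real_derivative (- \<gamma> s)) (at s)"
    and "0 \<le> \<delta>"
  shows "tailP \<gamma>1 \<delta> \<le> tailP \<gamma> \<delta>" and "tailP \<gamma>2 \<delta> \<le> tailP \<gamma> \<delta>"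
proof -
  define \<mu>1 where "\<mu>1 = density lebesgue (\<lambda>s. ennreal (\<gamma>1 s))"
  define \<mu>2 where "\<mu>2 = density lebesgue (\<lambda>s. ennreal (\<gamma>2 s))"
  have \<mu>1: "finite_measure \<mu>1" and \<mu>2: "finite_measure \<mu>2"
    unfolding \<mu>1_def \<mu>2_def using a1 a2 by (auto intro: finite_measure_density_admissible)
  have tails: "tailP \<gamma>1 t = ennreal (measure \<mu>1 {t..})" "tailP \<gamma>2 t = ennreal (measure \<mu>2 {t..})" for t
    using tailP_eq_measure[OF a1] tailP_eq_measure[OF a2] by (simp_all add: \<mu>1_def \<mu>2_def)
  define M where "M t = max (measure \<mu>1 {t..}) (measure \<mu>2 {t..})" for t
  interpret increments_dominated "density lebesgue (\<lambda>s. ennreal (\<gamma>1 s + \<gamma>2 s))" M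
    using increments_dominated_max_tails[OF a1 a2] by (simp add: tails M_def[abs_def])
  have "antimono M"
    unfolding antimono_def M_def
    by (intro allI impI max.mono finite_measure.finite_measure_mono[OF \<mu>1]
        finite_measure.finite_measure_mono[OF \<mu>2]) (auto simp: \<mu>1_def \<mu>2_def)
  moreover have "(M \<longlongrightarrow> 0) at_top"
    using tendsto_max[OF tendsto_measure_atLeast_at_top[OF \<mu>1] tendsto_measure_atLeast_at_top[OF \<mu>2]]
    by (simp add: M_def[abs_def] \<mu>1_def \<mu>2_def)
  moreover have "AE s in lebesgue. 0 \<le> s \<longrightarrow> (M has_real_derivative - \<gamma> s) (at s)"
    using der by (simp add: tails M_def[abs_def])
  ultimately have "ennreal (M \<delta>) \<le> tailP \<gamma> \<delta>"
    using \<open>0 \<le> \<delta>\<close> by (rule ennreal_le_tailP)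
  moreover have "tailP \<gamma>1 \<delta> \<le> ennreal (M \<delta>)" "tailP \<gamma>2 \<delta> \<le> ennreal (M \<delta>)"
    by (auto simp: tails M_def intro: ennreal_leI)
  ultimately show "tailP \<gamma>1 \<delta> \<le> tailP \<gamma> \<delta>" "tailP \<gamma>2 \<delta> \<le> tailP \<gamma> \<delta>"
    by (auto intro: order_trans)
qed

lemma nn_integral_convex_combination:
  fixes q :: "'b \<Rightarrow> 'a \<Rightarrow> real"
  assumes "finite I" and "\<And>i. i \<in> I \<Longrightarrow> 0 \<le> w i" and "\<And>i x. i \<in> I \<Longrightarrow> 0 \<le> q i x"
    and "\<And>i. i \<in> I \<Longrightarrow> q i \<in> borel_measurable M" and "A \<in> sets M"
  shows "(\<integral>\<^sup>+x\<in>A. ennreal (\<Sum>i\<in>I. w i * q i x) \<partial>M)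
       = (\<Sum>i\<in>I. ennreal (w i) * (\<integral>\<^sup>+x\<in>A. ennreal (q i x) \<partial>M))"
proof -
  have "(\<integral>\<^sup>+x\<in>A. ennreal (\<Sum>i\<in>I. w i * q i x) \<partial>M)
      = (\<integral>\<^sup>+x. (\<Sum>i\<in>I. ennreal (w i) * (ennreal (q i x) * indicator A x)) \<partial>M)"
    using assms
    by (intro nn_integral_cong)
       (simp add: sum_nonneg ennreal_mult sum_distrib_right mult.assoc flip: sum_ennreal)
  also have "\<dots> = (\<Sum>i\<in>I. ennreal (w i) * (\<integral>\<^sup>+x\<in>A. ennreal (q i x) \<partial>M))"
    using assms by (simp add: nn_integral_sum nn_integral_cmult)
  finally show ?thesis .
qed

lemma subspherical_convex_combination:
  fixes q :: "'b \<Rightarrow> 'a::euclidean_space \<Rightarrow> real"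
  assumes "finite I" and w0: "\<And>i. i \<in> I \<Longrightarrow> 0 \<le> w i" and w1: "(\<Sum>i\<in>I. w i) = 1"
    and q: "\<And>i. i \<in> I \<Longrightarrow> q i \<in> subspherical \<gamma>"
  shows "(\<lambda>x. \<Sum>i\<in>I. w i * q i x) \<in> subspherical \<gamma>"
proof -
  have q0: "\<And>i x. i \<in> I \<Longrightarrow> 0 \<le> q i x" and q_meas: "\<And>i. i \<in> I \<Longrightarrow> q i \<in> borel_measurable lebesgue"
    and q1: "\<And>i. i \<in> I \<Longrightarrow> (\<integral>\<^sup>+ x. ennreal (q i x) \<partial>lebesgue) = 1"
    and q_even: "\<And>i x. i \<in> I \<Longrightarrow> q i (- x) = q i x"
    and q_tail: "\<And>i e \<delta>. i \<in> I \<Longrightarrow> norm e = 1 \<Longrightarrow> 0 \<le> \<delta> \<Longrightarrow>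
         (\<integral>\<^sup>+ \<xi> \<in> {\<xi>. \<delta> \<le> e \<bullet> \<xi>}. ennreal (q i \<xi>) \<partial>lebesgue) \<le> tailP \<gamma> \<delta>"
    using q by (auto simp: subspherical_def prob_density_def)
  note combination = nn_integral_convex_combination[OF \<open>finite I\<close> w0 q0 q_meas]
  have "(\<integral>\<^sup>+ x. ennreal (\<Sum>i\<in>I. w i * q i x) \<partial>lebesgue) = (\<Sum>i\<in>I. ennreal (w i))"
    using combination[where A=UNIV] q1 by simp
  also have "\<dots> = 1"
    using w0 w1 by simp
  finally have total: "(\<integral>\<^sup>+ x. ennreal (\<Sum>i\<in>I. w i * q i x) \<partial>lebesgue) = 1" .
  have tail: "(\<integral>\<^sup>+ \<xi> \<in> {\<xi>. \<delta> \<le> e \<bullet> \<xi>}. ennreal (\<Sum>i\<in>I. w i * q i \<xi>) \<partial>lebesgue) \<le> tailP \<gamma> \<delta>"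
    if "norm e = 1" "0 \<le> \<delta>" for e :: 'a and \<delta>
  proof -
    have "{\<xi>. \<delta> \<le> e \<bullet> \<xi>} \<in> sets lebesgue"
      using closed_halfspace_ge[of \<delta> e] by (intro sets_completionI_sets) (simp add: borel_closed)
    then have "(\<integral>\<^sup>+ \<xi> \<in> {\<xi>. \<delta> \<le> e \<bullet> \<xi>}. ennreal (\<Sum>i\<in>I. w i * q i \<xi>) \<partial>lebesgue)
        = (\<Sum>i\<in>I. ennreal (w i) * (\<integral>\<^sup>+ \<xi> \<in> {\<xi>. \<delta> \<le> e \<bullet> \<xi>}. ennreal (q i \<xi>) \<partial>lebesgue))"
      by (simp add: combination)
    also have "\<dots> \<le> (\<Sum>i\<in>I. ennreal (w i) * tailP \<gamma> \<delta>)"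
      using that by (intro sum_mono mult_left_mono q_tail) auto
    also have "\<dots> = tailP \<gamma> \<delta>"
      using w0 w1 by (simp flip: sum_distrib_right)
    finally show ?thesis .
  qed
  show ?thesis
    unfolding subspherical_def prob_density_def
    using total tail q0 w0 q_even q_meas
    by (auto intro!: sum_nonneg borel_measurable_sum borel_measurable_times)
qed

theorem proposition2p3:
  fixes \<gamma>0 \<gamma>1 \<gamma>2 \<gamma> :: "real \<Rightarrow> real"
    and I :: "'b set" and w :: "'b \<Rightarrow> real" and q :: "'b \<Rightarrow> real ^ 'n \<Rightarrow> real"
  assumes "admissible_gamma \<gamma>0"
    and "admissible_gamma \<gamma>1" and "admissible_gamma \<gamma>2"
    and "\<forall>s. \<gamma> (- s) = \<gamma> s"
    and "AE s in lebesgue. 0 \<le> s \<longrightarrow>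
           ((\<lambda>t. max (enn2real (tailP \<gamma>1 t)) (enn2real (tailP \<gamma>2 t)))
              has_real_derivative (- \<gamma> s)) (at s)"
  shows "(finite I \<and> I \<noteq> {} \<and> (\<forall>i\<in>I. 0 \<le> w i) \<and> (\<Sum>i\<in>I. w i) = 1 \<and>
            (\<forall>i\<in>I. q i \<in> subspherical \<gamma>0)
           \<longrightarrow> (\<lambda>x. \<Sum>i\<in>I. w i * q i x) \<in> subspherical \<gamma>0)
       \<and> (subspherical \<gamma>1 \<union> subspherical \<gamma>2 \<subseteq> (subspherical \<gamma> :: (real ^ 'n \<Rightarrow> real) set))"
proof (intro conjI impI)
  show "(\<lambda>x. \<Sum>i\<in>I. w i * q i x) \<in> subspherical \<gamma>0"
    if "finite I \<and> I \<noteq> {} \<and> (\<forall>i\<in>I. 0 \<le> w i) \<and> (\<Sum>i\<in>I. w i) = 1 \<and>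
        (\<forall>i\<in>I. q i \<in> subspherical \<gamma>0)"
    using that by (intro subspherical_convex_combination) auto
  have "tailP \<gamma>1 \<delta> \<le> tailP \<gamma> \<delta>" "tailP \<gamma>2 \<delta> \<le> tailP \<gamma> \<delta>" if "0 \<le> \<delta>" for \<delta>
    using tailP_le_of_max_tailP_deriv[OF assms(2,3,5) that] by auto
  then show "subspherical \<gamma>1 \<union> subspherical \<gamma>2 \<subseteq> (subspherical \<gamma> :: (real ^ 'n \<Rightarrow> real) set)"
    unfolding subspherical_def by (fastforce intro: order_trans)
qed

end
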